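(* (1) If $G$ is a discrete countable group containing at least two elements, then $E(G)\sim_B E_0$. (2) If $G$ is an uncountable Polish group, then $E_0^\omega\le_B E(G)$. (3) If $G$ is a TSI non-archimedean uncountable Polish group, then $E(G)\sim_B E_0^\omega$. (4) If $G$ is a non-archimedean Polish group, then $E(G)\le_B {=^+}$.
   Context: For a Polish group $G$, $E(G)$ is the equivalence relation on $G^\omega$ given by $x\,E(G)\,y$ iff $(x(n)y(n)^{-1})_n$ converges in $G$. $E_0$ on $2^\omega$: $xE_0y$ iff $\exists m\,\forall n>m\,(x(n)=y(n))$. For an equivalence relation $E$ on $X$, $E^\omega$ on $X^\omega$ is $(x_n)E^\omega(y_n)$ iff $\forall n\,(x_nEy_n)$; $E^+$ on $X^\omega$ is $(x_n)E^+(y_n)$ iff $\forall n\exists m\,(x_nEy_m)$ and $\forall m\exists n\,(x_nEy_m)$; $=^+$ is $\mathrm{id}(\omega^\omega)^+$. TSI: admits a compatible two-sided invariant metric. Non-archimedean: has a neighborhood base of the identity consisting of open subgroups. $\le_B$ is Borel reducibility, $\sim_B$ mutual Borel reducibility. *)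

theory Defs
  imports "HOL-Analysis.Analysis"
begin

text \<open>
  Groups are written additively, following \<^class>\<open>group_add\<close>, which is not assumed commutative:
  \<open>0\<close> is the identity and \<open>x - y\<close> stands for \<open>x y\<^sup>-\<^sup>1\<close>. A Polish group is a type of sort
  \<open>{topological_group_add, polish_space}\<close>. The complete metric carried by \<^class>\<open>polish_space\<close>
  is an arbitrary compatible one, not assumed invariant; the notions below only use the topology.
\<close>

definition E_grp :: "(nat \<Rightarrow> 'a::topological_group_add) \<Rightarrow> (nat \<Rightarrow> 'a) \<Rightarrow> bool" where
  "E_grp x y \<longleftrightarrow> convergent (\<lambda>n. x n - y n)"

definition E0 :: "(nat \<Rightarrow> bool) \<Rightarrow> (nat \<Rightarrow> bool) \<Rightarrow> bool" where
  "E0 x y \<longleftrightarrow> (\<exists>m. \<forall>n>m. x n = y n)"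

definition rel_omega :: "('x \<Rightarrow> 'x \<Rightarrow> bool) \<Rightarrow> (nat \<Rightarrow> 'x) \<Rightarrow> (nat \<Rightarrow> 'x) \<Rightarrow> bool" where
  "rel_omega E x y \<longleftrightarrow> (\<forall>n. E (x n) (y n))"

definition rel_plus :: "('x \<Rightarrow> 'x \<Rightarrow> bool) \<Rightarrow> (nat \<Rightarrow> 'x) \<Rightarrow> (nat \<Rightarrow> 'x) \<Rightarrow> bool" where
  "rel_plus E x y \<longleftrightarrow> (\<forall>n. \<exists>m. E (x n) (y m)) \<and> (\<forall>m. \<exists>n. E (x n) (y m))"

definition eq_plus :: "(nat \<Rightarrow> nat \<Rightarrow> nat) \<Rightarrow> (nat \<Rightarrow> nat \<Rightarrow> nat) \<Rightarrow> bool" where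
  "eq_plus = rel_plus (\<lambda>(u :: nat \<Rightarrow> nat) v. u = v)"

text \<open>On sequence types, \<^const>\<open>borel\<close> is generated by the product topology.\<close>

definition borel_reducible ::
    "('x::topological_space \<Rightarrow> 'x \<Rightarrow> bool) \<Rightarrow> ('y::topological_space \<Rightarrow> 'y \<Rightarrow> bool) \<Rightarrow> bool"
    (infix \<open>\<le>\<^sub>B\<close> 50) where
  "E \<le>\<^sub>B F \<longleftrightarrow> (\<exists>f \<in> borel \<rightarrow>\<^sub>M borel. \<forall>x y. E x y \<longleftrightarrow> F (f x) (f y))"

definition borel_bireducible ::
    "('x::topological_space \<Rightarrow> 'x \<Rightarrow> bool) \<Rightarrow> ('y::topological_space \<Rightarrow> 'y \<Rightarrow> bool) \<Rightarrow> bool"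
    (infix \<open>\<sim>\<^sub>B\<close> 50) where
  "E \<sim>\<^sub>B F \<longleftrightarrow> E \<le>\<^sub>B F \<and> F \<le>\<^sub>B E"

definition is_TSI :: "'a::topological_group_add itself \<Rightarrow> bool" where
  "is_TSI _ \<longleftrightarrow> (\<exists>d :: 'a \<Rightarrow> 'a \<Rightarrow> real.
     Metric_space UNIV d \<and> Metric_space.mtopology UNIV d = euclidean \<and>
     (\<forall>a b x y. d (a + x + b) (a + y + b) = d x y))"

definition add_subgroup :: "'a::group_add set \<Rightarrow> bool" where
  "add_subgroup H \<longleftrightarrow> 0 \<in> H \<and> (\<forall>x\<in>H. \<forall>y\<in>H. x + y \<in> H) \<and> (\<forall>x\<in>H. - x \<in> H)"

definition is_nonarchimedean :: "'a::topological_group_add itself \<Rightarrow> bool" where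
  "is_nonarchimedean _ \<longleftrightarrow>
     (\<forall>U :: 'a set. open U \<and> 0 \<in> U \<longrightarrow> (\<exists>H. open H \<and> add_subgroup H \<and> H \<subseteq> U))"

end

theory Submission
  imports Defs
begin

section \<open>Completeness of Polish groups\<close>

text \<open>The metric is complete but not invariant, and one-sided Cauchy sequences need not
  converge: permutations of the naturals can tend pointwise to an injection that is not onto. So a
  criterion for \<open>convergent\<close> that does not mention the limit has to be two-sided.
  Extracting a fast subsequence of \<open>z\<close> directly would be circular: how close to
  \<open>0\<close> a difference must be for \<open>z m - z n + z p\<close> to be near
  \<open>z p\<close> depends on \<open>z p\<close>, hence on the index being chosen. The alternating
  sum avoids this because \<open>s j\<close> is fixed before \<open>p j\<close>. The criterion turns
  \<open>E_grp x y\<close> into countably many conditions on cosets of basic open subgroups. What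
  remains is the unknown limit of \<open>x n - y n\<close>, which acts on \<open>y\<close> as a left
  translation. For normal subgroups, which TSI supplies, both sides of the criterion agree and
  increments cancel the translation; this leads to \<open>rel_omega E0\<close>. For other subgroups
  the increments are comparable only up to conjugation by \<open>x n\<close>, so all translates by a
  dense sequence are listed as an unordered set instead; this leads to
  \<open>eq_plus\<close>.\<close>

lemma Cauchy_if_dist_le_half_power:
  fixes s :: "nat \<Rightarrow> 'a::metric_space"
  assumes "\<And>k. dist (s (Suc k)) (s k) \<le> (1/2) ^ k"
  shows "Cauchy s"
proof -
  \<comment> \<open>Retaining the subtracted tail lets the induction close without loss.\<close>
  have bound: "dist (s (m + j)) (s m) \<le> 2 * (1/2) ^ m - 2 * (1/2) ^ (m + j)" for m j
  proof (induction j)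
    case 0
    then show ?case by simp
  next
    case (Suc j)
    have "dist (s (m + Suc j)) (s m) \<le> dist (s (Suc (m + j))) (s (m + j)) + dist (s (m + j)) (s m)"
      using dist_triangle[of "s (m + Suc j)" "s m" "s (m + j)"] by simp
    also have "\<dots> \<le> (1/2) ^ (m + j) + (2 * (1/2) ^ m - 2 * (1/2) ^ (m + j))"
      using Suc assms[of "m + j"] by linarith
    finally show ?case by simp
  qed
  show ?thesis
    unfolding Cauchy_altdef2
  proof (intro allI impI)
    fix e :: real
    assume "e > 0"
    then obtain N where N: "(1/2) ^ N < e / 2"
      using real_arch_pow_inv[of "e / 2" "1/2"] by auto
    show "\<exists>N. \<forall>n\<ge>N. dist (s n) (s N) < e"
    proof (intro exI[of _ N] allI impI)
      fix n assume "N \<le> n"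
      then have "dist (s n) (s N) \<le> 2 * (1/2) ^ N - 2 * (1/2) ^ n"
        using bound[of N "n - N"] by simp
      moreover have "(0::real) < (1/2) ^ n" by simp
      ultimately show "dist (s n) (s N) < e" using N by linarith
    qed
  qed
qed

text \<open>
  The sums \<open>s (j + 1) = \<plusminus> z (p j) + s j\<close> with alternating signs satisfy
  \<open>s (j + 2) = \<mp> z (p (j + 1)) \<plusminus> z (p j) + s j\<close>, which is as close to \<open>s j\<close> as desired once \<open>p j\<close> is
  chosen large depending on \<open>s j\<close>. So the even and the odd terms of \<open>s\<close> both converge in the given
  complete metric, whence so does their difference \<open>z (p (2 k))\<close>.
\<close>
lemma convergent_if_two_sided_Cauchy:
  fixes z :: "nat \<Rightarrow> 'a::{topological_group_add, complete_space}"
  assumes left: "\<And>U. open U \<Longrightarrow> 0 \<in> U \<Longrightarrow> \<exists>N. \<forall>m\<ge>N. \<forall>n\<ge>N. - z m + z n \<in> U"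
    and right: "\<And>U. open U \<Longrightarrow> 0 \<in> U \<Longrightarrow> \<exists>N. \<forall>m\<ge>N. \<forall>n\<ge>N. z m - z n \<in> U"
  shows "convergent z"
proof -
  \<comment> \<open>\<open>w j (p (Suc j)) (p j)\<close> is what two consecutive steps add to
    \<open>s j\<close>; it is controlled by \<open>left\<close> for even \<open>j\<close> and by
    \<open>right\<close> for odd \<open>j\<close>.\<close>
  define w where "w j m n = (if even j then - z m + z n else z m - z n)" for j :: nat and m n
  define P where "P j = (\<lambda>(p, s). \<forall>m\<ge>p. \<forall>n\<ge>p. dist (w j m n + s) s < (1/2) ^ j)" for j
  define R where "R j = (\<lambda>(p, s) (p', s'). p < p' \<and> s' = (if even j then z p else - z p) + s)"
    for j :: nat
  have large: "\<exists>p\<ge>q. P j (p, s)" for j q s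
  proof -
    let ?U = "{g. dist (g + s) s < (1/2) ^ j}"
    have "open ?U" by (intro open_Collect_less continuous_intros)
    moreover have "0 \<in> ?U" by simp
    ultimately obtain N where "\<forall>m\<ge>N. \<forall>n\<ge>N. w j m n \<in> ?U"
      using left[of ?U] right[of ?U] unfolding w_def by (cases "even j") auto
    then have "P j (max N q, s)" by (auto simp: P_def)
    then show ?thesis by (intro exI[of _ "max N q"]) simp
  qed
  have "\<exists>f. \<forall>j. P j (f j) \<and> R j (f j) (f (Suc j))"
  proof (rule dependent_nat_choice)
    show "\<exists>x. P 0 x" using large by blast
    show "\<exists>y. P (Suc j) y \<and> R j x y" for x j
    proof -
      obtain p s where x: "x = (p, s)" by fastforce
      obtain p' where "p' \<ge> Suc p" "P (Suc j) (p', (if even j then z p else - z p) + s)"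
        using large by blast
      then show ?thesis by (intro exI conjI) (auto simp: x R_def)
    qed
  qed
  then obtain f where f: "\<And>j. P j (f j)" "\<And>j. R j (f j) (f (Suc j))" by blast
  define p s where "p = fst \<circ> f" and "s = snd \<circ> f"
  have s_Suc: "s (Suc j) = (if even j then z (p j) else - z (p j)) + s j"
    and p_less: "p j < p (Suc j)" for j
    using f(2)[of j] by (auto simp: R_def p_def s_def split_beta)
  have mono: "strict_mono p" using p_less by (simp add: strict_mono_Suc_iff)
  have close: "dist (s (Suc (Suc j))) (s j) < (1/2) ^ j" for j
  proof -
    have "dist (w j (p (Suc j)) (p j) + s j) (s j) < (1/2) ^ j"
      using f(1)[of j] p_less[of j] by (auto simp: P_def p_def s_def split_beta)
    moreover have "s (Suc (Suc j)) = w j (p (Suc j)) (p j) + s j"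
      by (simp add: s_Suc w_def add.assoc[symmetric])
    ultimately show ?thesis by simp
  qed
  have conv: "convergent (\<lambda>k. s (2 * k + i))" for i
  proof -
    have "dist (s (2 * Suc k + i)) (s (2 * k + i)) \<le> (1/2) ^ k" for k
    proof -
      have "dist (s (2 * Suc k + i)) (s (2 * k + i)) \<le> (1/2) ^ (2 * k + i)"
        using close[of "2 * k + i"] by simp
      also have "\<dots> \<le> (1/2) ^ k" by (intro power_decreasing) auto
      finally show ?thesis .
    qed
    then show ?thesis
      by (intro Cauchy_convergent Cauchy_if_dist_le_half_power)
  qed
  obtain h v where "(\<lambda>k. s (2 * k)) \<longlonglongrightarrow> h" "(\<lambda>k. s (2 * k + 1)) \<longlonglongrightarrow> v"
    using conv[of 0] conv[of 1] by (auto simp: convergent_def)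
  then have "(\<lambda>k. s (2 * k + 1) - s (2 * k)) \<longlonglongrightarrow> v - h" by (intro tendsto_intros)
  then have sub: "(\<lambda>k. z (p (2 * k))) \<longlonglongrightarrow> v - h" by (simp add: s_Suc)
  have "(\<lambda>k. z k - z (p (2 * k))) \<longlonglongrightarrow> 0"
  proof (rule topological_tendstoI)
    fix U :: "'a set"
    assume "open U" "0 \<in> U"
    then obtain N where N: "\<forall>m\<ge>N. \<forall>n\<ge>N. z m - z n \<in> U" using right by blast
    have "k \<le> p (2 * k)" for k using seq_suble[OF mono, of "2 * k"] by simp
    then show "\<forall>\<^sub>F k in sequentially. z k - z (p (2 * k)) \<in> U"
      using N order_trans unfolding eventually_sequentially by blast
  qed
  from tendsto_add[OF this sub] show ?thesis by (auto simp: convergent_def)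
qed

section \<open>Open subgroups and their cosets\<close>

text \<open>The Knuth-Bendix completion of the group axioms, with differences unfolded:
  \<open>simp only\<close> decides word identities without commutativity.\<close>

lemmas group_normalize =
  diff_conv_add_uminus minus_add minus_minus minus_zero add.assoc add_minus_cancel minus_add_cancel
  right_minus left_minus add_0_left add_0_right

lemma add_subgroup_diff_commute:
  assumes "add_subgroup H"
  shows "x - y \<in> H \<longleftrightarrow> y - x \<in> H"
  using assms unfolding add_subgroup_def by (metis minus_diff_eq)

lemma add_subgroup_diff_trans:
  assumes "add_subgroup H" "x - y \<in> H" "y - t \<in> H"
  shows "x - t \<in> H"
proof -
  have "(x - y) + (y - t) \<in> H" using assms unfolding add_subgroup_def by blast
  moreover have "(x - y) + (y - t) = x - t" by (simp only: group_normalize)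
  ultimately show ?thesis by simp
qed

lemma open_diff_Collect:
  fixes H :: "'a::topological_group_add set"
  assumes "open H"
  shows "open {h. h - g \<in> H}"
proof -
  have "continuous_on UNIV (\<lambda>h. h - g)" by (intro continuous_intros)
  from open_vimage[OF assms this] show ?thesis by (simp add: vimage_def)
qed

lemma dense_sequence_exists:
  obtains d :: "nat \<Rightarrow> 'a::second_countable_topology"
  where "\<And>U. open U \<Longrightarrow> U \<noteq> {} \<Longrightarrow> \<exists>i. d i \<in> U"
proof -
  obtain D :: "'a set" where D: "countable D" "\<And>U. open U \<Longrightarrow> U \<noteq> {} \<Longrightarrow> \<exists>x\<in>D. x \<in> U"
    by (rule countable_dense_setE) blast
  then have "\<exists>i. from_nat_into D i \<in> U" if "open U" "U \<noteq> {}" for U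
    using that by (metis from_nat_into_surj)
  then show ?thesis using that by blast
qed

text \<open>A numbering of the right cosets \<open>H + g\<close>. Continuity of \<open>c\<close> is
  what makes the later reductions continuous.\<close>

definition coset_code :: "'a::topological_group_add set \<Rightarrow> ('a \<Rightarrow> nat) \<Rightarrow> bool" where
  "coset_code H c \<longleftrightarrow> continuous_on UNIV c \<and> (\<forall>g h. c g = c h \<longleftrightarrow> g - h \<in> H)"

text \<open>Cosets of \<open>H\<close> are open, so a dense sequence meets each of them, and the
  least index of a dense point in the coset can serve as its number. Preimages under this numbering
  are unions of cosets.\<close>

lemma coset_code_exists:
  fixes H :: "'a::{topological_group_add, second_countable_topology} set"
  assumes H: "open H" "add_subgroup H"
  shows "\<exists>c. coset_code H c"
proof -
  obtain d :: "nat \<Rightarrow> 'a" where d: "\<And>U. open U \<Longrightarrow> U \<noteq> {} \<Longrightarrow> \<exists>i. d i \<in> U"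
    using dense_sequence_exists by blast
  define c where "c g = (LEAST i. g - d i \<in> H)" for g
  have c: "g - d (c g) \<in> H" for g
  proof -
    have "g \<in> {h. h - g \<in> H}" using H by (simp add: add_subgroup_def)
    then obtain i where "d i - g \<in> H" using d open_diff_Collect[OF H(1), of g] by blast
    then have "g - d i \<in> H" using add_subgroup_diff_commute H(2) by blast
    then show ?thesis unfolding c_def by (rule LeastI)
  qed
  have iff: "c g = c h \<longleftrightarrow> g - h \<in> H" for g h
  proof
    assume "c g = c h"
    then show "g - h \<in> H"
      using c[of g] c[of h] add_subgroup_diff_commute[OF H(2)] add_subgroup_diff_trans[OF H(2)]
      by metis
  next
    assume "g - h \<in> H"
    then have "(\<lambda>i. g - d i \<in> H) = (\<lambda>i. h - d i \<in> H)"
      using add_subgroup_diff_commute[OF H(2)] add_subgroup_diff_trans[OF H(2)] by blast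
    then show "c g = c h" by (simp add: c_def)
  qed
  have "continuous_on UNIV c"
    unfolding continuous_on_open_vimage[OF open_UNIV]
  proof (intro allI impI)
    fix B :: "nat set"
    have "c -` B = (\<Union>g\<in>c -` B. {h. h - g \<in> H})"
      using H(2) by (auto simp flip: iff)
    then show "open (c -` B \<inter> UNIV)"
      using open_diff_Collect[OF H(1)] by (metis inf_top_right open_UN)
  qed
  then show ?thesis using iff by (auto simp: coset_code_def)
qed

text \<open>\<open>P\<close> is kept abstract to serve both for open subgroups and for normal open
  subgroups.\<close>

lemma countable_base_at_zero:
  assumes "\<And>U :: 'a::{zero, first_countable_topology} set.
    open U \<Longrightarrow> 0 \<in> U \<Longrightarrow> \<exists>H. P H \<and> H \<subseteq> U"
  shows "\<exists>H :: nat \<Rightarrow> 'a set. (\<forall>k. P (H k)) \<and> (\<forall>U. open U \<longrightarrow> 0 \<in> U \<longrightarrow> (\<exists>k. H k \<subseteq> U))"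
proof -
  obtain A :: "nat \<Rightarrow> 'a set" where A: "\<And>i. open (A i)" "\<And>i. 0 \<in> A i"
    "\<And>S. open S \<Longrightarrow> 0 \<in> S \<Longrightarrow> eventually (\<lambda>i. A i \<subseteq> S) sequentially"
    using countable_basis_at_decseq[of "0::'a"] by blast
  have "\<forall>k. \<exists>H. P H \<and> H \<subseteq> A k" using assms A by blast
  then obtain H where "\<And>k. P (H k) \<and> H k \<subseteq> A k" by metis
  then show ?thesis using A(3) unfolding eventually_sequentially by (meson order_refl subset_trans)
qed

section \<open>Normal open subgroups\<close>

definition normal_subset :: "'a::group_add set \<Rightarrow> bool" where
  "normal_subset N \<longleftrightarrow> (\<forall>g. \<forall>h\<in>N. g + h - g \<in> N)"

lemma normal_subset_conj_iff:
  assumes "normal_subset N"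
  shows "g + h - g \<in> N \<longleftrightarrow> h \<in> N"
proof
  assume "g + h - g \<in> N"
  then have "- g + (g + h - g) - (- g) \<in> N" using assms unfolding normal_subset_def by blast
  then show "h \<in> N" by (simp only: group_normalize)
qed (use assms in \<open>auto simp: normal_subset_def\<close>)

text \<open>
  The intersection of all conjugates of an open subgroup contains a ball of the invariant metric,
  because such a ball is invariant under conjugation.
\<close>
lemma open_normal_subgroup_exists:
  fixes U :: "'a::topological_group_add set"
  assumes "is_TSI TYPE('a)" "is_nonarchimedean TYPE('a)" "open U" "0 \<in> U"
  shows "\<exists>N. (open N \<and> add_subgroup N \<and> normal_subset N) \<and> N \<subseteq> U"
proof -
  obtain d :: "'a \<Rightarrow> 'a \<Rightarrow> real" where d: "Metric_space UNIV d"
    "Metric_space.mtopology UNIV d = euclidean"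
    and inv: "\<And>a b x y. d (a + x + b) (a + y + b) = d x y"
    using assms(1) unfolding is_TSI_def by blast
  interpret Metric_space UNIV d by fact
  obtain H where H: "open H" "add_subgroup H" "H \<subseteq> U"
    using assms(2-4) unfolding is_nonarchimedean_def by blast
  define N where "N = {h. \<forall>g. g + h - g \<in> H}"
  have sub: "add_subgroup N"
    unfolding add_subgroup_def
  proof (intro conjI ballI)
    show "0 \<in> N" using H(2) by (simp add: N_def add_subgroup_def)
  next
    fix x y assume xy: "x \<in> N" "y \<in> N"
    have "(g + x - g) + (g + y - g) \<in> H" for g
      using xy H(2) by (auto simp: N_def add_subgroup_def)
    moreover have "(g + x - g) + (g + y - g) = g + (x + y) - g" for g
      by (simp only: group_normalize)
    ultimately show "x + y \<in> N" by (simp add: N_def)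
  next
    fix x assume x: "x \<in> N"
    have "- (g + x - g) \<in> H" for g
      using x H(2) unfolding N_def add_subgroup_def by blast
    moreover have "- (g + x - g) = g + (- x) - g" for g
      by (simp only: group_normalize)
    ultimately show "- x \<in> N" by (simp add: N_def)
  qed
  have "g + h - g \<in> N" if "h \<in> N" for g h
  proof -
    have "(k + g) + h - (k + g) \<in> H" for k using that by (simp add: N_def)
    moreover have "(k + g) + h - (k + g) = k + (g + h - g) - k" for k
      by (simp only: group_normalize)
    ultimately show ?thesis by (simp add: N_def)
  qed
  then have norm: "normal_subset N" by (simp add: normal_subset_def)
  have open_iff: "open S \<longleftrightarrow> openin mtopology S" for S by (subst d(2)) (rule open_openin)
  have "openin mtopology H" using H(1) open_iff by blast
  then obtain r where r: "r > 0" "mball 0 r \<subseteq> H"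
    using H(2) unfolding openin_mtopology add_subgroup_def by blast
  have ball: "mball 0 r \<subseteq> N"
  proof
    fix h assume "h \<in> mball 0 r"
    then have "d 0 h < r" by simp
    moreover have "d 0 (g + h - g) = d 0 h" for g
      using inv[of g 0 "- g" h] by simp
    ultimately have "g + h - g \<in> mball 0 r" for g by simp
    then show "h \<in> N" using r(2) by (auto simp: N_def)
  qed
  have "open (mball 0 r)" using openin_mball open_iff by blast
  \<comment> \<open>A subgroup containing a neighbourhood of \<open>0\<close> is a union of
    translates of that neighbourhood, hence open.\<close>
  have "N = (\<Union>g\<in>N. {h. h - g \<in> mball 0 r})"
  proof (intro equalityI subsetI)
    fix h assume "h \<in> N"
    then show "h \<in> (\<Union>g\<in>N. {h. h - g \<in> mball 0 r})" using r(1) by (auto intro!: bexI[of _ h])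
  next
    fix h assume "h \<in> (\<Union>g\<in>N. {h. h - g \<in> mball 0 r})"
    then obtain g where "g \<in> N" "h - g \<in> N" using ball by blast
    then have "(h - g) + g \<in> N" using sub unfolding add_subgroup_def by blast
    then show "h \<in> N" by simp
  qed
  then have "open N"
    using open_diff_Collect[OF \<open>open (mball 0 r)\<close>] by (metis open_UN)
  moreover have "N \<subseteq> U"
  proof
    fix h assume "h \<in> N"
    then have "0 + h - 0 \<in> H" unfolding N_def by blast
    then show "h \<in> U" using H(3) by auto
  qed
  ultimately show ?thesis using sub norm by blast
qed

section \<open>Reductions\<close>

text \<open>Every reduction constructed below is continuous, so this is the only source of Borel
  measurability.\<close>

lemma borel_reducible_if_continuous:
  assumes "continuous_on UNIV f" "\<And>x y. E x y \<longleftrightarrow> F (f x) (f y)"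
  shows "E \<le>\<^sub>B F"
  unfolding borel_reducible_def
  using assms by (intro bexI[of _ f]) (auto intro: borel_measurable_continuous_onI)

lemma continuous_on_from_discrete:
  fixes g :: "'b::discrete_topology \<Rightarrow> 'c::topological_space"
  assumes "continuous_on S f"
  shows "continuous_on S (\<lambda>x. g (f x))"
  by (rule continuous_on_compose2[OF _ assms, of UNIV])
    (auto simp: continuous_on_open_vimage[OF open_UNIV] open_discrete)

text \<open>Inversion is continuous and maps \<open>x n - y n\<close> to
  \<open>y n - x n\<close>.\<close>

lemma E_grp_commute: "E_grp x y \<longleftrightarrow> E_grp y x"
proof -
  have "E_grp y x" if E: "E_grp x y" for x y :: "nat \<Rightarrow> 'a"
  proof -
    obtain g where "(\<lambda>n. x n - y n) \<longlonglongrightarrow> g" using E by (auto simp: E_grp_def convergent_def)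
    from tendsto_minus[OF this] show ?thesis by (auto simp: E_grp_def convergent_def)
  qed
  then show ?thesis by blast
qed

lemma E0_iff_finite: "E0 x y \<longleftrightarrow> finite {n. x n \<noteq> y n}"
proof
  assume "E0 x y"
  then obtain m where "\<forall>n>m. x n = y n" by (auto simp: E0_def)
  then have "{n. x n \<noteq> y n} \<subseteq> {..m}" by (auto simp: not_less[symmetric])
  then show "finite {n. x n \<noteq> y n}" using finite_subset by blast
next
  assume "finite {n. x n \<noteq> y n}"
  then obtain m where "\<forall>n\<in>{n. x n \<noteq> y n}. n \<le> m" using finite_nat_set_iff_bounded_le by auto
  then show "E0 x y" by (auto simp: E0_def not_le[symmetric])
qed

section \<open>Coset increments as points of Cantor space\<close>

text \<open>The characteristic function of the graph of \<open>u\<close>, with pairs coded by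
  naturals. It brings eventual equality of number sequences down to binary sequences.\<close>

definition graph_code :: "(nat \<Rightarrow> nat) \<Rightarrow> nat \<Rightarrow> bool" where
  "graph_code u = (\<lambda>m. u (fst (prod_decode m)) = snd (prod_decode m))"

text \<open>
  A graph has exactly one point above each \<open>n\<close>, so two graphs differ in finitely many points
  exactly when the functions differ at finitely many arguments.
\<close>
lemma E0_graph_code: "E0 (graph_code u) (graph_code v) \<longleftrightarrow> eventually (\<lambda>n. u n = v n) sequentially"
proof -
  let ?D = "{n. u n \<noteq> v n}"
  let ?A = "{m. graph_code u m \<noteq> graph_code v m}"
  have sub: "?A \<subseteq> prod_encode ` ((\<lambda>n. (n, u n)) ` ?D \<union> (\<lambda>n. (n, v n)) ` ?D)"
  proof
    fix m assume m: "m \<in> ?A"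
    obtain n i where ni: "prod_decode m = (n, i)" by fastforce
    then have "m = prod_encode (n, i)" by (metis prod_decode_inverse)
    then show "m \<in> prod_encode ` ((\<lambda>n. (n, u n)) ` ?D \<union> (\<lambda>n. (n, v n)) ` ?D)"
      using m by (auto simp: graph_code_def)
  qed
  have "?D \<subseteq> (fst \<circ> prod_decode) ` ?A"
  proof
    fix n assume "n \<in> ?D"
    then have "prod_encode (n, u n) \<in> ?A" by (auto simp: graph_code_def)
    then have "(fst \<circ> prod_decode) (prod_encode (n, u n)) \<in> (fst \<circ> prod_decode) ` ?A"
      by (rule imageI)
    then show "n \<in> (fst \<circ> prod_decode) ` ?A" by simp
  qed
  with sub have "finite ?A \<longleftrightarrow> finite ?D"
    by (metis (no_types, lifting) finite_Un finite_imageI finite_subset)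
  then show ?thesis
    by (simp add: E0_iff_finite cofinite_eq_sequentially[symmetric] eventually_cofinite)
qed

definition increment_code :: "('a::group_add \<Rightarrow> nat) \<Rightarrow> (nat \<Rightarrow> 'a) \<Rightarrow> nat \<Rightarrow> bool" where
  "increment_code c x = graph_code (\<lambda>n. c (- x n + x (Suc n)))"

lemma continuous_increment_code:
  assumes "coset_code N c"
  shows "continuous_on UNIV (increment_code c)"
proof (rule continuous_on_coordinatewise_then_product)
  fix m
  obtain n i where ni: "prod_decode m = (n, i)" by fastforce
  have "continuous_on UNIV c" using assms by (simp add: coset_code_def)
  moreover have "continuous_on UNIV (\<lambda>x :: nat \<Rightarrow> 'a. - x n + x (Suc n))"
    by (intro continuous_on_add continuous_on_minus continuous_on_product_coordinates)
  ultimately have "continuous_on UNIV (\<lambda>x. c (- x n + x (Suc n)))"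
    by (rule continuous_on_compose2) simp
  from continuous_on_from_discrete[OF this, of "\<lambda>j. j = i"]
  show "continuous_on UNIV (\<lambda>x. increment_code c x m)"
    by (simp add: increment_code_def graph_code_def ni)
qed

text \<open>
  The increments \<open>- x n + x (n + 1)\<close> are unchanged by left translation, and \<open>x n - y n\<close> is eventually
  constant modulo \<open>N\<close> iff the increments of \<open>x\<close> and \<open>y\<close> eventually agree modulo \<open>N\<close>.
\<close>
lemma E0_increment_code:
  assumes N: "add_subgroup N" "normal_subset N" and c: "coset_code N c"
  shows "E0 (increment_code c x) (increment_code c y)
    \<longleftrightarrow> (\<exists>K. \<forall>n\<ge>K. (x n - y n) - (x K - y K) \<in> N)"
proof -
  let ?z = "\<lambda>n. x n - y n"
  \<comment> \<open>A step of \<open>?z\<close> is the conjugate by \<open>x n\<close> of the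
    difference of the two increments; normality of \<open>N\<close> removes the conjugation.\<close>
  have "?z (Suc n) - ?z n = x n + ((- x n + x (Suc n)) - (- y n + y (Suc n))) - x n" for n
    by (simp only: group_normalize)
  then have "c (- x n + x (Suc n)) = c (- y n + y (Suc n)) \<longleftrightarrow> ?z (Suc n) - ?z n \<in> N" for n
    using c normal_subset_conj_iff[OF N(2)] by (simp add: coset_code_def)
  then have "E0 (increment_code c x) (increment_code c y)
      \<longleftrightarrow> (\<exists>K. \<forall>n\<ge>K. ?z (Suc n) - ?z n \<in> N)"
    by (simp add: increment_code_def E0_graph_code eventually_sequentially)
  \<comment> \<open>The same \<open>K\<close> works on both sides, since the steps telescope inside
    the subgroup.\<close>
  also have "\<dots> \<longleftrightarrow> (\<exists>K. \<forall>n\<ge>K. ?z n - ?z K \<in> N)"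
  proof (intro iff_exI iffI)
    fix K assume K: "\<forall>n\<ge>K. ?z (Suc n) - ?z n \<in> N"
    show "\<forall>n\<ge>K. ?z n - ?z K \<in> N"
    proof (intro allI impI)
      fix n assume "K \<le> n"
      then show "?z n - ?z K \<in> N"
      proof (induction n rule: dec_induct)
        case base
        then show ?case using N(1) by (simp add: add_subgroup_def)
      next
        case (step n)
        then show ?case using K add_subgroup_diff_trans[OF N(1)] by blast
      qed
    qed
  next
    fix K assume "\<forall>n\<ge>K. ?z n - ?z K \<in> N"
    then show "\<forall>n\<ge>K. ?z (Suc n) - ?z n \<in> N"
      using add_subgroup_diff_commute[OF N(1)] add_subgroup_diff_trans[OF N(1)]
      by (metis le_SucI)
  qed
  finally show ?thesis .
qed

text \<open>The right coset of the limit is open and therefore contains a tail of the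
  sequence.\<close>

lemma convergent_imp_eventually_coset:
  fixes z :: "nat \<Rightarrow> 'a::topological_group_add"
  assumes "convergent z" "open H" "add_subgroup H"
  shows "\<exists>K. \<forall>n\<ge>K. z n - z K \<in> H"
proof -
  obtain g where "z \<longlonglongrightarrow> g" using assms(1) by (auto simp: convergent_def)
  then have "(\<lambda>n. z n - g) \<longlonglongrightarrow> g - g" by (intro tendsto_intros)
  moreover have "g - g \<in> H" using assms(3) by (simp add: add_subgroup_def)
  ultimately have "\<forall>\<^sub>F n in sequentially. z n - g \<in> H" using assms(2) topological_tendstoD by blast
  then obtain K where "\<forall>n\<ge>K. z n - g \<in> H" by (auto simp: eventually_sequentially)
  then show ?thesis
    using add_subgroup_diff_commute[OF assms(3)] add_subgroup_diff_trans[OF assms(3)] by (metis order_refl)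
qed

section \<open>Upper bounds from normal open subgroups\<close>

text \<open>Coordinate \<open>k\<close> tests whether \<open>x n - y n\<close> is eventually
  constant modulo \<open>N k\<close>. As the \<open>N k\<close> shrink to \<open>0\<close>, all
  tests together amount to the two-sided Cauchy condition.\<close>

lemma E_grp_le_omega_E0:
  fixes N :: "nat \<Rightarrow> 'a::{topological_group_add, polish_space} set"
  assumes N: "\<And>k. open (N k)" "\<And>k. add_subgroup (N k)" "\<And>k. normal_subset (N k)"
    and base: "\<And>U. open U \<Longrightarrow> 0 \<in> U \<Longrightarrow> \<exists>k. N k \<subseteq> U"
  shows "(E_grp :: (nat \<Rightarrow> 'a) \<Rightarrow> _) \<le>\<^sub>B rel_omega E0"
proof -
  have "\<forall>k. \<exists>c. coset_code (N k) c" using N(1,2) coset_code_exists by blast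
  then obtain c where c: "\<And>k. coset_code (N k) (c k)" by metis
  show ?thesis
  proof (rule borel_reducible_if_continuous[of "\<lambda>x k. increment_code (c k) x"])
    show "continuous_on UNIV (\<lambda>x k. increment_code (c k) x)"
      using continuous_increment_code[OF c] by (rule continuous_on_coordinatewise_then_product)
  next
    fix x y :: "nat \<Rightarrow> 'a"
    let ?z = "\<lambda>n. x n - y n"
    have "convergent ?z \<longleftrightarrow> (\<forall>k. \<exists>K. \<forall>n\<ge>K. ?z n - ?z K \<in> N k)"
    proof
      assume "convergent ?z"
      then show "\<forall>k. \<exists>K. \<forall>n\<ge>K. ?z n - ?z K \<in> N k"
        using convergent_imp_eventually_coset N(1,2) by blast
    next
      assume *: "\<forall>k. \<exists>K. \<forall>n\<ge>K. ?z n - ?z K \<in> N k"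
      have ev: "\<exists>K. \<forall>m\<ge>K. \<forall>n\<ge>K. ?z m - ?z n \<in> N k" for k
        using * add_subgroup_diff_commute[OF N(2)] add_subgroup_diff_trans[OF N(2)] by meson
      \<comment> \<open>Conjugation by \<open>g\<close> takes \<open>- g + h\<close> to
        \<open>h - g\<close>, so normality yields the left condition from the right one.\<close>
      have "- g + h \<in> N k \<longleftrightarrow> h - g \<in> N k" for g h k
        using normal_subset_conj_iff[OF N(3), of g "- g + h" k] by (simp add: add.assoc[symmetric])
      then have ev': "\<exists>K. \<forall>m\<ge>K. \<forall>n\<ge>K. - ?z m + ?z n \<in> N k" for k
        using ev[of k] by metis
      show "convergent ?z"
        using base ev ev' by (intro convergent_if_two_sided_Cauchy) (meson subsetD)+
    qed
    then show "E_grp x y \<longleftrightarrow>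
        rel_omega E0 (\<lambda>k. increment_code (c k) x) (\<lambda>k. increment_code (c k) y)"
      by (simp add: E_grp_def rel_omega_def E0_increment_code[OF N(2,3) c])
  qed
qed

text \<open>Here \<open>{0}\<close> is itself an open normal subgroup, and convergence is eventual
  constancy modulo it, so a single coordinate suffices.\<close>

lemma discrete_E_grp_le_E0:
  assumes discrete: "\<And>S :: 'a::{topological_group_add, polish_space} set. open S"
  shows "(E_grp :: (nat \<Rightarrow> 'a) \<Rightarrow> _) \<le>\<^sub>B E0"
proof -
  let ?N = "{0 :: 'a}"
  have N: "add_subgroup ?N" "normal_subset ?N" by (auto simp: add_subgroup_def normal_subset_def)
  obtain c where c: "coset_code ?N c" using coset_code_exists[OF discrete N(1)] by blast
  show ?thesis
  proof (rule borel_reducible_if_continuous[OF continuous_increment_code[OF c]])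
    fix x y :: "nat \<Rightarrow> 'a"
    let ?z = "\<lambda>n. x n - y n"
    have "convergent ?z" if "\<forall>n\<ge>K. ?z n - ?z K \<in> ?N" for K
    proof -
      have "\<forall>\<^sub>F n in sequentially. ?z n = ?z K"
        using that unfolding eventually_sequentially by (metis right_minus_eq singletonD)
      from tendsto_eventually[OF this] show ?thesis unfolding convergent_def by (rule exI)
    qed
    moreover have "\<exists>K. \<forall>n\<ge>K. ?z n - ?z K \<in> ?N" if "convergent ?z"
      by (rule convergent_imp_eventually_coset[OF that discrete N(1)])
    ultimately show "E_grp x y \<longleftrightarrow> E0 (increment_code c x) (increment_code c y)"
      unfolding E0_increment_code[OF N c] E_grp_def by blast
  qed
qed

section \<open>Lower bounds\<close>

text \<open>
  Interleaving with the constant sequence \<open>0\<close> forces the limit of the difference of two sequences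
  to be \<open>0\<close>.
\<close>
definition zero_interleave :: "(nat \<Rightarrow> 'a::zero) \<Rightarrow> nat \<Rightarrow> 'a" where
  "zero_interleave x n = (if even n then 0 else x (n div 2))"

lemma E_grp_zero_interleave:
  fixes x y :: "nat \<Rightarrow> 'a::{topological_group_add, t2_space}"
  shows "E_grp (zero_interleave x) (zero_interleave y) \<longleftrightarrow> (\<lambda>n. x n - y n) \<longlonglongrightarrow> 0"
proof
  let ?w = "\<lambda>n. zero_interleave x n - zero_interleave y n"
  assume "E_grp (zero_interleave x) (zero_interleave y)"
  then obtain g where g: "?w \<longlonglongrightarrow> g" by (auto simp: E_grp_def convergent_def)
  have "strict_mono (\<lambda>n::nat. 2 * n)" "strict_mono (\<lambda>n::nat. 2 * n + 1)"
    by (auto simp: strict_mono_def)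
  from this[THEN LIMSEQ_subseq_LIMSEQ[OF g]]
  have "(\<lambda>n. 0) \<longlonglongrightarrow> g" "(\<lambda>n. x n - y n) \<longlonglongrightarrow> g" by (simp_all add: o_def zero_interleave_def)
  then show "(\<lambda>n. x n - y n) \<longlonglongrightarrow> 0" using LIMSEQ_unique tendsto_const by metis
next
  let ?w = "\<lambda>n. zero_interleave x n - zero_interleave y n"
  assume lim: "(\<lambda>n. x n - y n) \<longlonglongrightarrow> 0"
  have "?w \<longlonglongrightarrow> 0"
  proof (rule topological_tendstoI)
    fix U :: "'a set" assume U: "open U" "0 \<in> U"
    then obtain K where K: "\<And>n. n \<ge> K \<Longrightarrow> x n - y n \<in> U"
      using topological_tendstoD[OF lim] by (auto simp: eventually_sequentially)
    have "?w n \<in> U" if "n \<ge> 2 * K" for n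
      using K[of "n div 2"] U(2) that by (auto simp: zero_interleave_def)
    then show "\<forall>\<^sub>F n in sequentially. ?w n \<in> U" by (auto simp: eventually_sequentially)
  qed
  then show "E_grp (zero_interleave x) (zero_interleave y)" by (auto simp: E_grp_def convergent_def)
qed

lemma continuous_zero_interleave:
  "continuous_on UNIV (zero_interleave :: (nat \<Rightarrow> 'a::{zero, topological_space}) \<Rightarrow> _)"
proof (rule continuous_on_coordinatewise_then_product)
  show "continuous_on UNIV (\<lambda>x :: nat \<Rightarrow> 'a. zero_interleave x n)" for n
    by (cases "even n") (simp_all add: zero_interleave_def)
qed

lemma continuous_if_coordinate:
  "continuous_on UNIV (\<lambda>x :: 'i \<Rightarrow> bool. if x n then a else (b :: 'a::topological_space))"
  by (rule continuous_on_from_discrete[where g = "\<lambda>t. if t then a else b"]) simp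

text \<open>Differences of sequences in \<open>0\<close> and \<open>a\<close> take only the values
  \<open>0\<close>, \<open>a\<close>, \<open>- a\<close>, so they tend to \<open>0\<close> iff they
  eventually vanish. Interleaving is essential: the constant sequences \<open>a\<close> and
  \<open>0\<close> have a convergent difference but come from points that are not
  \<open>E0\<close>-related.\<close>

lemma E0_le_E_grp:
  fixes a :: "'a::{topological_group_add, t2_space}"
  assumes "a \<noteq> 0"
  shows "E0 \<le>\<^sub>B (E_grp :: (nat \<Rightarrow> 'a) \<Rightarrow> _)"
proof -
  define f where "f x n = (if x n then a else 0)" for x and n :: nat
  show ?thesis
  proof (rule borel_reducible_if_continuous[of "\<lambda>x. zero_interleave (f x)"])
    have "continuous_on UNIV f"
      unfolding f_def by (intro continuous_on_coordinatewise_then_product continuous_if_coordinate)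
    then show "continuous_on UNIV (\<lambda>x. zero_interleave (f x))"
      by (rule continuous_on_compose2[OF continuous_zero_interleave]) simp
  next
    fix x y :: "nat \<Rightarrow> bool"
    have iff: "f x n - f y n = 0 \<longleftrightarrow> x n = y n" for n using assms by (auto simp: f_def)
    have "(\<lambda>n. f x n - f y n) \<longlonglongrightarrow> 0 \<longleftrightarrow> (\<forall>\<^sub>F n in sequentially. x n = y n)"
    proof
      assume lim: "(\<lambda>n. f x n - f y n) \<longlonglongrightarrow> 0"
      have "open (- {a, - a})" by (intro open_Compl finite_imp_closed) simp
      then have "\<forall>\<^sub>F n in sequentially. f x n - f y n \<in> - {a, - a}"
        using assms by (intro topological_tendstoD[OF lim]) auto
      then show "\<forall>\<^sub>F n in sequentially. x n = y n"
        by (rule eventually_mono) (auto simp: f_def split: if_splits)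
    next
      assume "\<forall>\<^sub>F n in sequentially. x n = y n"
      then have "\<forall>\<^sub>F n in sequentially. f x n - f y n = 0" by (simp only: iff)
      then show "(\<lambda>n. f x n - f y n) \<longlonglongrightarrow> 0" by (rule tendsto_eventually)
    qed
    then show "E0 x y \<longleftrightarrow> E_grp (zero_interleave (f x)) (zero_interleave (f y))"
      unfolding E_grp_zero_interleave E0_iff_finite
      by (simp add: cofinite_eq_sequentially[symmetric] eventually_cofinite)
  qed
qed

text \<open>If \<open>{0}\<close> were open, its coset code would inject the group into the
  naturals; hence \<open>0\<close> is a limit point.\<close>

lemma null_sequence_exists:
  assumes "uncountable (UNIV :: 'a::{topological_group_add, polish_space} set)"
  shows "\<exists>g :: nat \<Rightarrow> 'a. (\<forall>i. g i \<noteq> 0) \<and> g \<longlonglongrightarrow> 0"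
proof -
  have "\<not> open {0 :: 'a}"
  proof
    assume op: "open {0 :: 'a}"
    have "add_subgroup {0 :: 'a}" by (simp add: add_subgroup_def)
    then obtain c :: "'a \<Rightarrow> nat" where "coset_code {0} c" using coset_code_exists[OF op] by blast
    then have "inj c" by (auto simp: coset_code_def inj_def)
    then show False using assms by (metis countableI)
  qed
  then have "(0::'a) islimpt UNIV" by (simp add: islimpt_UNIV_iff)
  then show ?thesis unfolding islimpt_sequential by auto
qed

text \<open>Row \<open>i\<close> is written with the letters \<open>0\<close> and
  \<open>g i\<close>. Since \<open>g\<close> is null, only finitely many rows can leave a given
  neighbourhood of \<open>0\<close>, and \<open>E0\<close> allows finitely many disagreements in
  each. Conversely, infinitely many disagreements in row \<open>i\<close> keep producing
  \<open>g i\<close> or \<open>- g i\<close>, which stay away from \<open>0\<close>.\<close>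

lemma omega_E0_le_E_grp:
  assumes "uncountable (UNIV :: 'a::{topological_group_add, polish_space} set)"
  shows "rel_omega E0 \<le>\<^sub>B (E_grp :: (nat \<Rightarrow> 'a) \<Rightarrow> _)"
proof -
  obtain g :: "nat \<Rightarrow> 'a" where g: "\<And>i. g i \<noteq> 0" "g \<longlonglongrightarrow> 0"
    using null_sequence_exists[OF assms] by blast
  define f where "f x m = (case prod_decode m of (i, n) \<Rightarrow> if x i n then g i else 0)"
    for x :: "nat \<Rightarrow> nat \<Rightarrow> bool" and m
  show ?thesis
  proof (rule borel_reducible_if_continuous[of "\<lambda>x. zero_interleave (f x)"])
    have "continuous_on UNIV (\<lambda>x. f x m)" for m
    proof -
      obtain i n where m: "prod_decode m = (i, n)" by fastforce
      have "continuous_on UNIV (\<lambda>x :: nat \<Rightarrow> nat \<Rightarrow> bool. if x i n then g i else 0)"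
        by (rule continuous_on_compose2[OF continuous_if_coordinate[of n "g i" 0]
              continuous_on_product_coordinates[of i]]) simp
      then show ?thesis by (simp add: f_def m)
    qed
    then have "continuous_on UNIV f" by (rule continuous_on_coordinatewise_then_product)
    then show "continuous_on UNIV (\<lambda>x. zero_interleave (f x))"
      by (rule continuous_on_compose2[OF continuous_zero_interleave]) simp
  next
    fix x y :: "nat \<Rightarrow> nat \<Rightarrow> bool"
    have "(\<lambda>m. f x m - f y m) \<longlonglongrightarrow> 0 \<longleftrightarrow> (\<forall>i. finite {n. x i n \<noteq> y i n})"
    proof
      assume lim: "(\<lambda>m. f x m - f y m) \<longlonglongrightarrow> 0"
      show "\<forall>i. finite {n. x i n \<noteq> y i n}"
      proof
        fix i
        \<comment> \<open>A neighbourhood of \<open>0\<close> that omits both values a disagreement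
          in row \<open>i\<close> can produce.\<close>
        have "open (- {g i, - g i})" by (intro open_Compl finite_imp_closed) simp
        then have "\<forall>\<^sub>F m in sequentially. f x m - f y m \<in> - {g i, - g i}"
          using g(1)[of i] by (intro topological_tendstoD[OF lim]) auto
        then have "finite {m. f x m - f y m \<in> {g i, - g i}}"
          by (simp add: cofinite_eq_sequentially[symmetric] eventually_cofinite)
        moreover have "(\<lambda>n. prod_encode (i, n)) ` {n. x i n \<noteq> y i n}
            \<subseteq> {m. f x m - f y m \<in> {g i, - g i}}"
          by (auto simp: f_def)
        ultimately have "finite ((\<lambda>n. prod_encode (i, n)) ` {n. x i n \<noteq> y i n})"
          using finite_subset by blast
        then show "finite {n. x i n \<noteq> y i n}"
          by (rule finite_imageD) (auto simp: inj_on_def)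
      qed
    next
      assume fin: "\<forall>i. finite {n. x i n \<noteq> y i n}"
      show "(\<lambda>m. f x m - f y m) \<longlonglongrightarrow> 0"
      proof (rule topological_tendstoI)
        fix U :: "'a set" assume U: "open U" "0 \<in> U"
        have "(\<lambda>i. - g i) \<longlonglongrightarrow> 0" using tendsto_minus[OF g(2)] by simp
        then have "\<forall>\<^sub>F i in sequentially. g i \<in> U \<and> - g i \<in> U"
          using topological_tendstoD[OF g(2) U] topological_tendstoD[OF _ U] eventually_conj by blast
        then obtain I where I: "\<And>i. i \<ge> I \<Longrightarrow> g i \<in> U \<and> - g i \<in> U"
          by (auto simp: eventually_sequentially)
        have "m \<in> prod_encode ` (SIGMA i:{..<I}. {n. x i n \<noteq> y i n})"
          if "f x m - f y m \<notin> U" for m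
        proof -
          obtain i n where m: "prod_decode m = (i, n)" by fastforce
          then have "x i n \<noteq> y i n" "i < I"
            using that U(2) I[of i] by (auto simp: f_def not_less[symmetric] split: if_splits)
          moreover have "m = prod_encode (i, n)" using m by (metis prod_decode_inverse)
          ultimately show ?thesis by auto
        qed
        then have "{m. f x m - f y m \<notin> U} \<subseteq> prod_encode ` (SIGMA i:{..<I}. {n. x i n \<noteq> y i n})"
          by blast
        moreover have "finite (prod_encode ` (SIGMA i:{..<I}. {n. x i n \<noteq> y i n}))"
          using fin by (intro finite_imageI finite_SigmaI) auto
        ultimately have "finite {m. f x m - f y m \<notin> U}" using finite_subset by blast
        then show "\<forall>\<^sub>F m in sequentially. f x m - f y m \<in> U"
          by (simp add: cofinite_eq_sequentially[symmetric] eventually_cofinite)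
      qed
    qed
    then show "rel_omega E0 x y \<longleftrightarrow> E_grp (zero_interleave (f x)) (zero_interleave (f y))"
      by (simp add: E_grp_zero_interleave rel_omega_def E0_iff_finite)
  qed
qed

section \<open>Non-archimedean groups and countable sets of coset sequences\<close>

text \<open>
  For fixed \<open>k\<close> the countable set attached to \<open>x\<close> is closed under finite modifications and consists
  of the sequences of right \<open>H k\<close>-cosets that eventually agree with some left translate of \<open>x\<close>.
  If the sets of \<open>x\<close> and \<open>y\<close> agree, then \<open>x n - y n\<close> and \<open>y n - x n\<close> both lie eventually in a single
  right coset of each \<open>H k\<close>, so \<open>x n - y n\<close> is two-sided Cauchy. Entry \<open>0\<close> of a sequence records \<open>k\<close>.
\<close>
lemma nonarchimedean_E_grp_le_eq_plus:
  assumes "is_nonarchimedean TYPE('a::{topological_group_add, polish_space})"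
  shows "(E_grp :: (nat \<Rightarrow> 'a) \<Rightarrow> _) \<le>\<^sub>B eq_plus"
proof -
  have "\<exists>H :: nat \<Rightarrow> 'a set. (\<forall>k. open (H k) \<and> add_subgroup (H k)) \<and>
      (\<forall>U. open U \<longrightarrow> 0 \<in> U \<longrightarrow> (\<exists>k. H k \<subseteq> U))"
    using assms unfolding is_nonarchimedean_def by (intro countable_base_at_zero) blast
  then obtain H :: "nat \<Rightarrow> 'a set" where H: "\<And>k. open (H k)" "\<And>k. add_subgroup (H k)"
    and base: "\<And>U. open U \<Longrightarrow> 0 \<in> U \<Longrightarrow> \<exists>k. H k \<subseteq> U" by blast
  have "\<forall>k. \<exists>c. coset_code (H k) c" using H coset_code_exists by blast
  then obtain c where c: "\<And>k. coset_code (H k) (c k)" by metis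
  then have c_iff: "c k g = c k h \<longleftrightarrow> g - h \<in> H k" for k g h by (simp add: coset_code_def)
  obtain d :: "nat \<Rightarrow> 'a" where d: "\<And>U. open U \<Longrightarrow> U \<noteq> {} \<Longrightarrow> \<exists>i. d i \<in> U"
    using dense_sequence_exists by blast
  \<comment> \<open>Because entry \<open>0\<close> is the tag, \<open>x n\<close> is recorded at
    entry \<open>n + 1\<close>. The list \<open>s\<close> overwrites an initial segment after the
    tag; \<open>i\<close> selects the left translate.\<close>
  define w where "w x k i s = (\<lambda>n. if n = 0 then k else
      if n \<le> length s then s ! (n - 1) else c k (d i + x (n - 1)))" for x k i and s :: "nat list"
  define f where "f x m = (case from_nat m of (k, i, s) \<Rightarrow> w x k i s)" for x and m :: nat
  have f_to_nat: "f x (to_nat (k, i, s)) = w x k i s" for x k i s by (simp add: f_def)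
  have f_obtain: "\<exists>k i s. f x m = w x k i s" for x m
    unfolding f_def by (cases "from_nat m :: nat \<times> nat \<times> nat list") auto
  have forward: "\<exists>m'. f x m = f y m'" if E: "E_grp x y" for x y m
  proof -
    obtain k i s where m: "f x m = w x k i s" using f_obtain by blast
    obtain g where g: "(\<lambda>n. x n - y n) \<longlonglongrightarrow> g" using E by (auto simp: E_grp_def convergent_def)
    \<comment> \<open>Eventually \<open>d i + x n\<close> is near \<open>d i + g + y n\<close>. As
      \<open>d i + g\<close> need not occur in the dense sequence, some \<open>d j\<close> in its
      open coset replaces it.\<close>
    have "d i + g \<in> {h. h - (d i + g) \<in> H k}" using H(2) by (simp add: add_subgroup_def)
    then obtain j where "d j - (d i + g) \<in> H k" using d open_diff_Collect[OF H(1)] by blast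
    then have "d i + g - d j \<in> H k" using add_subgroup_diff_commute H(2) by blast
    moreover have "(\<lambda>n. d i + (x n - y n) - d j) \<longlonglongrightarrow> d i + g - d j"
      using g by (intro tendsto_intros)
    ultimately have "\<forall>\<^sub>F n in sequentially. d i + (x n - y n) - d j \<in> H k"
      using topological_tendstoD H(1) by blast
    then obtain K where K: "\<And>n. n \<ge> K \<Longrightarrow> d i + (x n - y n) - d j \<in> H k"
      by (auto simp: eventually_sequentially)
    have eq: "c k (d i + x n) = c k (d j + y n)" if "n \<ge> K" for n
    proof -
      have "d i + x n - (d j + y n) = d i + (x n - y n) - d j" by (simp only: group_normalize)
      then show ?thesis using K[OF that] by (simp add: c_iff)
    qed
    \<comment> \<open>The new prefix spans both the old one and the indices before \<open>K\<close>,
      where the cosets may still differ.\<close>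
    define t where "t = map (\<lambda>n. w x k i s (Suc n)) [0..<max K (length s)]"
    have "w x k i s = w y k j t"
    proof
      fix n
      show "w x k i s n = w y k j t n"
      proof (cases "n = 0 \<or> n \<le> length t")
        case True
        have "w y k j t (Suc l) = w x k i s (Suc l)" if "l < length t" for l
        proof -
          have "w y k j t (Suc l) = t ! l" using that by (simp add: w_def)
          also have "\<dots> = w x k i s (Suc l)" using that by (simp add: t_def)
          finally show ?thesis .
        qed
        moreover have "w y k j t 0 = w x k i s 0" by (simp add: w_def)
        ultimately show ?thesis using True by (cases n) auto
      next
        case False
        then show ?thesis using eq[of "n - 1"] by (auto simp: w_def t_def)
      qed
    qed
    then show ?thesis using m f_to_nat by metis
  qed
  have backward: "\<exists>K. \<forall>m\<ge>K. \<forall>n\<ge>K. (x m - y m) - (x n - y n) \<in> H k"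
    if sub: "\<And>m. \<exists>m'. f x m = f y m'" for x y k
  proof -
    have "0 \<in> H k" using H(2) by (simp add: add_subgroup_def)
    \<comment> \<open>For \<open>d i\<close> inside \<open>H k\<close>, conjugation by
      \<open>d i\<close> preserves \<open>H k\<close> even without normality. It moves
      \<open>x n - y n\<close> into the coset of \<open>- d i + d j\<close>, which does not depend
      on \<open>n\<close>.\<close>
    then obtain i where i: "d i \<in> H k" using d H(1) by blast
    obtain m' where "f x (to_nat (k, i, [] :: nat list)) = f y m'"
      using sub by blast
    then obtain k' j t where eq: "w x k i [] = w y k' j t" using f_to_nat f_obtain by metis
    have "k' = k" using fun_cong[OF eq, of 0] by (simp add: w_def)
    have coset: "x n - y n - (- d i + d j) \<in> H k" if "n \<ge> length t" for n
    proof -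
      have "c k (d i + x n) = c k (d j + y n)"
        using fun_cong[OF eq, of "Suc n"] that \<open>k' = k\<close> by (simp add: w_def)
      then have "d i + x n - (d j + y n) \<in> H k" by (simp add: c_iff)
      then have "- d i + (d i + x n - (d j + y n)) + d i \<in> H k"
        using i H(2)[of k] unfolding add_subgroup_def by blast
      moreover have "- d i + (d i + x n - (d j + y n)) + d i = x n - y n - (- d i + d j)"
        by (simp only: group_normalize)
      ultimately show ?thesis by simp
    qed
    then show ?thesis
      using add_subgroup_diff_commute[OF H(2)] add_subgroup_diff_trans[OF H(2)] by meson
  qed
  show ?thesis
  proof (rule borel_reducible_if_continuous[of f])
    have "continuous_on UNIV (\<lambda>x. w x k i s n)" for k i s n
    proof -
      have "continuous_on UNIV (c k)" using c by (simp add: coset_code_def)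
      moreover have "continuous_on UNIV (\<lambda>x. d i + x (n - 1))"
        by (intro continuous_on_add continuous_on_const continuous_on_product_coordinates)
      ultimately have "continuous_on UNIV (\<lambda>x. c k (d i + x (n - 1)))"
        by (rule continuous_on_compose2) simp
      then show ?thesis unfolding w_def by (cases "n = 0"; cases "n \<le> length s") simp_all
    qed
    then have "continuous_on UNIV (\<lambda>x. f x m n)" for m n
      by (cases "from_nat m :: nat \<times> nat \<times> nat list") (simp add: f_def)
    then have "continuous_on UNIV (\<lambda>x. f x m)" for m
      by (rule continuous_on_coordinatewise_then_product)
    then show "continuous_on UNIV f" by (rule continuous_on_coordinatewise_then_product)
  next
    fix x y :: "nat \<Rightarrow> 'a"
    let ?z = "\<lambda>n. x n - y n"
    show "E_grp x y \<longleftrightarrow> eq_plus (f x) (f y)"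
    proof
      assume "E_grp x y"
      then show "eq_plus (f x) (f y)"
        using forward E_grp_commute unfolding eq_plus_def rel_plus_def by metis
    next
      assume "eq_plus (f x) (f y)"
      then have *: "\<And>m. \<exists>m'. f x m = f y m'" "\<And>m. \<exists>m'. f y m = f x m'"
        unfolding eq_plus_def rel_plus_def by metis+
      have "(y m - x m) - (y n - x n) = - ?z m + ?z n" for m n
        by (simp only: group_normalize)
      then have "\<exists>K. \<forall>m\<ge>K. \<forall>n\<ge>K. - ?z m + ?z n \<in> H k" for k
        using backward[OF *(2), of k] by simp
      then show "E_grp x y"
        unfolding E_grp_def using base backward[OF *(1)]
        by (intro convergent_if_two_sided_Cauchy) (meson subsetD)+
    qed
  qed
qed

theorem theorem3p5:
  fixes G :: "'a::{topological_group_add, polish_space} itself"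
  shows "((\<forall>S :: 'a set. open S) \<and> countable (UNIV :: 'a set) \<and> (\<exists>a b :: 'a. a \<noteq> b)
           \<longrightarrow> (E_grp :: (nat \<Rightarrow> 'a) \<Rightarrow> _) \<sim>\<^sub>B E0)
       \<and> (uncountable (UNIV :: 'a set)
           \<longrightarrow> rel_omega E0 \<le>\<^sub>B (E_grp :: (nat \<Rightarrow> 'a) \<Rightarrow> _))
       \<and> (is_TSI TYPE('a) \<and> is_nonarchimedean TYPE('a) \<and> uncountable (UNIV :: 'a set)
           \<longrightarrow> (E_grp :: (nat \<Rightarrow> 'a) \<Rightarrow> _) \<sim>\<^sub>B rel_omega E0)
       \<and> (is_nonarchimedean TYPE('a)
           \<longrightarrow> (E_grp :: (nat \<Rightarrow> 'a) \<Rightarrow> _) \<le>\<^sub>B eq_plus)"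
proof (intro conjI impI)
  assume *: "(\<forall>S :: 'a set. open S) \<and> countable (UNIV :: 'a set) \<and> (\<exists>a b :: 'a. a \<noteq> b)"
  then obtain a :: 'a where "a \<noteq> 0" by metis
  then show "(E_grp :: (nat \<Rightarrow> 'a) \<Rightarrow> _) \<sim>\<^sub>B E0"
    using * discrete_E_grp_le_E0 E0_le_E_grp unfolding borel_bireducible_def by blast
next
  assume *: "is_TSI TYPE('a) \<and> is_nonarchimedean TYPE('a) \<and> uncountable (UNIV :: 'a set)"
  have "\<exists>N :: nat \<Rightarrow> 'a set. (\<forall>k. open (N k) \<and> add_subgroup (N k) \<and> normal_subset (N k)) \<and>
      (\<forall>U. open U \<longrightarrow> 0 \<in> U \<longrightarrow> (\<exists>k. N k \<subseteq> U))"
    using * by (intro countable_base_at_zero open_normal_subgroup_exists) auto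
  then have "(E_grp :: (nat \<Rightarrow> 'a) \<Rightarrow> _) \<le>\<^sub>B rel_omega E0"
    using E_grp_le_omega_E0 by blast
  then show "(E_grp :: (nat \<Rightarrow> 'a) \<Rightarrow> _) \<sim>\<^sub>B rel_omega E0"
    using * omega_E0_le_E_grp unfolding borel_bireducible_def by blast
qed (simp_all add: omega_E0_le_E_grp nonarchimedean_E_grp_le_eq_plus)

end
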